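(* Let $T$ be an ergodic measure preserving automorphism of a standard probability space $(X,\mathcal{S},\mu)$, let $d\geq1$, and let $f\colon X\to\mathbb{R}^d$ be a Borel map. Suppose that either the distributions (under $\mu$) of the random variables $\mathbf{f}(n,\cdot)/n^{1/d}$, $n\geq1$, are uniformly tight, or there exist $\varepsilon,K>0$ such that $\mu(\{x\in X:\|\mathbf{f}(n,x)/n^{1/d}\|\leq K\})>\varepsilon$ for every $n\geq1$. Then the map $\tilde f\colon X\times X\to\mathbb{R}^d$, $\tilde f(x,y)=f(x)-f(y)$, is recurrent with respect to the automorphism $S=T\times T$ of $(X\times X,\mathcal{S}\otimes\mathcal{S},\mu\times\mu)$.
   Context: For a measure preserving automorphism $T$ of a probability space $(X,\mathcal{S},\mu)$ and a Borel map $f\colon X\to\mathbb{R}^d$, the cocycle $\mathbf{f}\colon\mathbb{Z}\times X\to\mathbb{R}^d$ is defined by $\mathbf{f}(n,x)=f(T^{n-1}x)+\dots+f(x)$ for $n>0$, $\mathbf{f}(0,x)=0$, and $\mathbf{f}(n,x)=-\mathbf{f}(-n,T^nx)$ for $n<0$. The function $f$ is called recurrent if $\liminf_{n\to\infty}\|\mathbf{f}(n,x)\|=0$ for $\mu$-a.e. $x\in X$; here $\|\cdot\|$ denotes the maximum norm on $\mathbb{R}^d$ (recurrence does not depend on the choice of norm). For $\tilde f$ and $S=T\times T$ the cocycle $\tilde{\mathbf{f}}$ is defined by the same formula with $S,\tilde f$ in place of $T,f$, and recurrence of $\tilde f$ means $\liminf_{n\to\infty}\|\tilde{\mathbf{f}}(n,(x,y))\|=0$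 for $(\mu\times\mu)$-a.e. $(x,y)$. *)

theory Defs
  imports "HOL-Probability.Probability"
begin

definition measure_preserving :: "'a measure \<Rightarrow> ('a \<Rightarrow> 'a) \<Rightarrow> bool" where
  "measure_preserving M T \<longleftrightarrow> T \<in> M \<rightarrow>\<^sub>M M \<and> distr M M T = M"

definition mp_automorphism :: "'a measure \<Rightarrow> ('a \<Rightarrow> 'a) \<Rightarrow> bool" where
  "mp_automorphism M T \<longleftrightarrow>
     bij_betw T (space M) (space M) \<and>
     measure_preserving M T \<and>
     measure_preserving M (inv_into (space M) T)"

definition ergodic :: "'a measure \<Rightarrow> ('a \<Rightarrow> 'a) \<Rightarrow> bool" where
  "ergodic M T \<longleftrightarrow>
     (\<forall>A\<in>sets M. T -` A \<inter> space M = A \<longrightarrow> emeasure M A = 0 \<or> emeasure M A = 1)"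

text \<open>The cocycle f(n,x) = f(T^(n-1) x) + ... + f(x) for n >= 0
  (only nonnegative times are needed in the statement).\<close>
definition cocycle :: "('a \<Rightarrow> 'a) \<Rightarrow> ('a \<Rightarrow> 'b::comm_monoid_add) \<Rightarrow> nat \<Rightarrow> 'a \<Rightarrow> 'b" where
  "cocycle T f n x = (\<Sum>k<n. f ((T ^^ k) x))"

definition maxnorm :: "real ^ 'n::finite \<Rightarrow> real" where
  "maxnorm v = Max (range (\<lambda>i. \<bar>v $ i\<bar>))"

definition recurrent :: "'a measure \<Rightarrow> ('a \<Rightarrow> 'a) \<Rightarrow> ('a \<Rightarrow> real ^ 'n::finite) \<Rightarrow> bool" where
  "recurrent M T f \<longleftrightarrow>
     (AE x in M. liminf (\<lambda>n. ereal (maxnorm (cocycle T f n x))) = 0)"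

definition uniformly_tight :: "'a measure \<Rightarrow> (nat \<Rightarrow> 'a \<Rightarrow> real ^ 'n::finite) \<Rightarrow> bool" where
  "uniformly_tight M g \<longleftrightarrow>
     (\<forall>e>0. \<exists>K. compact K \<and> (\<forall>n\<ge>1. measure (distr M borel (g n)) K > 1 - e))"

end

theory Submission
  imports Defs
begin

text \<open>Write \<open>F n (x, y)\<close> for the difference of the cocycles at \<open>x\<close> and \<open>y\<close>. Cutting the cube
  of radius \<open>K n\<^bsup>1/d\<^esup>\<close> into cells of side \<open>r\<close> and applying Cauchy-Schwarz to the cell
  probabilities shows that \<open>|F n| \<le> r\<close> has probability at least \<open>b r\<^sup>d / n\<close> for \<open>n \<ge> r\<^sup>d\<close>, and
  these bounds sum to a logarithmically large multiple of \<open>r\<^sup>d\<close>.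

  If \<open>F\<close> is not recurrent, some set \<open>C\<close> of positive measure satisfies \<open>|F n| > s\<close> on \<open>C\<close> for all
  \<open>n \<ge> N\<close>. Along an orbit the values of \<open>F\<close> at visits to \<open>C\<close> are then separated, so at most
  \<open>c r\<^sup>d\<close> of them lie in any ball of radius \<open>r\<close>. This bound carries over from \<open>C\<close> to a set of
  measure arbitrarily close to 1 with the constant \<open>c\<close> changing only by a fixed factor: although
  \<open>T \<times> T\<close> need not be ergodic, the maps \<open>T \<times> id\<close> and \<open>id \<times> T\<close> together are; they commute with
  \<open>T \<times> T\<close> and change \<open>F\<close> only by a coboundary. By the mean ergodic theorem suitable averages of
  the indicator of \<open>C\<close> over their compositions exceed half the measure of \<open>C\<close> outside a small
  set, and the displacement caused by boundedly many of them is negligible for large \<open>r\<close>.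
  Comparing both estimates of the expected number of visits contradicts the logarithmic
  divergence.\<close>

subsection \<open>Grids and separated sequences\<close>

lemma maxnorm_eq_infnorm: "maxnorm v = infnorm v"
proof -
  have "{\<bar>v $ i\<bar> |i. i \<in> UNIV} = range (\<lambda>i. \<bar>v $ i\<bar>)"
    by auto
  then show ?thesis
    by (simp add: maxnorm_def infnorm_cart cSup_eq_Max)
qed

lemma infnorm_le_iff:
  fixes v :: "'b::euclidean_space"
  shows "infnorm v \<le> R \<longleftrightarrow> (\<forall>i\<in>Basis. \<bar>v \<bullet> i\<bar> \<le> R)"
  by (simp add: infnorm_Max)

lemma borel_measurable_infnorm [measurable]:
  "(infnorm :: 'b::euclidean_space \<Rightarrow> real) \<in> borel_measurable borel"
  by (intro borel_measurable_continuous_onI continuous_intros)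

definition grid_cell :: "real \<Rightarrow> 'b::euclidean_space \<Rightarrow> 'b \<Rightarrow> int" where
  "grid_cell s v = (\<lambda>i\<in>Basis. \<lfloor>v \<bullet> i / s\<rfloor>)"

definition grid_box :: "real \<Rightarrow> real \<Rightarrow> ('b::euclidean_space \<Rightarrow> int) set" where
  "grid_box s R = (Basis \<rightarrow>\<^sub>E {\<lfloor>- R / s\<rfloor>..\<lfloor>R / s\<rfloor>})"

lemma finite_grid_box [simp]: "finite (grid_box s R)"
  by (simp add: grid_box_def finite_PiE)

lemma card_grid_box_le:
  assumes "s > 0" "R \<ge> 0"
  shows "real (card (grid_box s R :: ('b::euclidean_space \<Rightarrow> int) set)) \<le> (2 * R / s + 2) ^ DIM('b)"
proof -
  have "R / s \<ge> 0"
    using assms by simp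
  then have "real (card {\<lfloor>- R / s\<rfloor>..\<lfloor>R / s\<rfloor>}) \<le> 2 * R / s + 2"
    by simp linarith
  then show ?thesis
    by (simp add: grid_box_def card_PiE power_mono)
qed

lemma grid_cell_in_grid_box:
  assumes "s > 0" "infnorm v \<le> R"
  shows "grid_cell s v \<in> grid_box s R"
proof -
  have "- R / s \<le> v \<bullet> i / s" "v \<bullet> i / s \<le> R / s" if "i \<in> Basis" for i
    using assms that unfolding infnorm_le_iff
    by (intro divide_right_mono; fastforce simp: abs_le_iff)+
  then show ?thesis
    by (auto simp: grid_cell_def grid_box_def intro!: floor_mono)
qed

lemma infnorm_diff_le_if_grid_cell_eq:
  assumes "s > 0" and same_cell: "grid_cell s v = grid_cell s w"
  shows "infnorm (v - w) \<le> s"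
  unfolding infnorm_le_iff
proof
  fix i :: 'a
  assume "i \<in> Basis"
  then have "\<lfloor>v \<bullet> i / s\<rfloor> = \<lfloor>w \<bullet> i / s\<rfloor>"
    using fun_cong[OF same_cell, of i] by (simp add: grid_cell_def)
  then have "\<bar>v \<bullet> i / s - w \<bullet> i / s\<bar> \<le> 1"
    by linarith
  then show "\<bar>(v - w) \<bullet> i\<bar> \<le> s"
    using \<open>s > 0\<close> by (simp add: diff_divide_distrib[symmetric] inner_diff_left)
qed

lemma measurable_grid_cell_eq [measurable]:
  assumes [measurable]: "g \<in> borel_measurable M"
  shows "Measurable.pred M (\<lambda>x. grid_cell s (g x) = b)"
proof -
  have "grid_cell s v = b \<longleftrightarrow> b \<in> extensional Basis \<and> (\<forall>i\<in>Basis. \<lfloor>v \<bullet> i / s\<rfloor> = b i)" for v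
    by (auto simp: grid_cell_def fun_eq_iff extensional_def restrict_def)
  then show ?thesis
    by simp
qed

lemma card_le_if_diff_less:
  fixes V :: "nat set"
  assumes "finite V" "\<And>m n. m \<in> V \<Longrightarrow> n \<in> V \<Longrightarrow> n < m + N"
  shows "card V \<le> N"
proof (cases "V = {}")
  case False
  then have "Min V \<in> V"
    using \<open>finite V\<close> by simp
  then have "V \<subseteq> {Min V..<Min V + N}"
    using assms by (auto intro!: Min_le)
  then show ?thesis
    using card_mono[of "{Min V..<Min V + N}" V] by simp
qed simp

lemma card_separated_le:
  fixes a :: "nat \<Rightarrow> 'b::euclidean_space"
  assumes "s > 0" "R \<ge> 0" "finite V"
    and separated: "\<And>m n. m \<in> V \<Longrightarrow> n \<in> V \<Longrightarrow> m + N \<le> n \<Longrightarrow> infnorm (a n - a m) > s"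
    and near: "\<And>n. n \<in> V \<Longrightarrow> infnorm (a n - q) \<le> R"
  shows "real (card V) \<le> real N * (2 * R / s + 2) ^ DIM('b)"
proof -
  define B where "B = (grid_box s R :: ('b \<Rightarrow> int) set)"
  define cell where "cell n = grid_cell s (a n - q)" for n
  have "infnorm (0 :: 'b) \<le> R"
    using \<open>R \<ge> 0\<close> by (simp add: infnorm_0)
  then have "B \<noteq> {}"
    using grid_cell_in_grid_box[OF \<open>s > 0\<close>, of "0 :: 'b" R] by (auto simp: B_def)
  moreover have "cell \<in> V \<rightarrow> B"
    using grid_cell_in_grid_box[OF \<open>s > 0\<close> near] by (simp add: cell_def B_def)
  ultimately obtain b where "card V \<le> card (cell -` {b} \<inter> V) * card B"
    using pigeonhole_card[of cell V B] \<open>finite V\<close> by (auto simp: B_def)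
  moreover have "card (cell -` {b} \<inter> V) \<le> N"
  proof (rule card_le_if_diff_less)
    fix m n
    assume mn: "m \<in> cell -` {b} \<inter> V" "n \<in> cell -` {b} \<inter> V"
    then have "infnorm ((a n - q) - (a m - q)) \<le> s"
      by (intro infnorm_diff_le_if_grid_cell_eq \<open>s > 0\<close>) (simp add: cell_def)
    then show "n < m + N"
      using separated[of m n] mn by (cases "n < m + N") auto
  qed (use \<open>finite V\<close> in simp)
  ultimately have "card V \<le> N * card B"
    by (meson mult_le_mono1 order_trans)
  then have "real (card V) \<le> real N * real (card B)"
    by (metis of_nat_le_iff of_nat_mult)
  also have "\<dots> \<le> real N * (2 * R / s + 2) ^ DIM('b)"
    unfolding B_def by (intro mult_left_mono card_grid_box_le assms) simp
  finally show ?thesis .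
qed

lemma (in prob_space) prob_UN_squared_le_prob_UN_Times:
  assumes "finite B" "disjoint_family_on A B" and [measurable]: "\<And>b. A b \<in> events"
  shows "(prob (\<Union>b\<in>B. A b))\<^sup>2 \<le> measure (M \<Otimes>\<^sub>M M) (\<Union>b\<in>B. A b \<times> A b) * card B"
proof -
  interpret P: pair_prob_space M M ..
  have "(prob (\<Union>b\<in>B. A b))\<^sup>2 = (\<Sum>b\<in>B. prob (A b))\<^sup>2"
    using assms by (simp add: finite_measure_finite_Union image_subset_iff)
  also have "\<dots> \<le> (\<Sum>b\<in>B. (prob (A b))\<^sup>2) * card B"
    by (rule sum_squared_le_sum_of_squares)
  also have "(\<Sum>b\<in>B. (prob (A b))\<^sup>2) = (\<Sum>b\<in>B. P.prob (A b \<times> A b))"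
    by (simp add: measure_def emeasure_pair_measure_Times enn2real_mult power2_eq_square)
  also have "\<dots> = P.prob (\<Union>b\<in>B. A b \<times> A b)"
    using assms by (intro P.finite_measure_finite_Union[symmetric])
      (auto simp: image_subset_iff disjoint_family_on_def)
  finally show ?thesis .
qed

lemma (in prob_space) prob_infnorm_difference_ge:
  fixes g :: "'a \<Rightarrow> 'b::euclidean_space"
  assumes [measurable]: "g \<in> borel_measurable M" and "r > 0" "Q \<ge> 0"
  shows "(prob {x \<in> space M. infnorm (g x) \<le> Q})\<^sup>2 / (2 * Q / r + 2) ^ DIM('b)
    \<le> measure (M \<Otimes>\<^sub>M M) {z \<in> space (M \<Otimes>\<^sub>M M). infnorm (g (fst z) - g (snd z)) \<le> r}"
    (is "_ \<le> measure _ ?near")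
proof -
  interpret P: pair_prob_space M M ..
  define B where "B = (grid_box r Q :: ('b \<Rightarrow> int) set)"
  define A where "A b = {x \<in> space M. infnorm (g x) \<le> Q \<and> grid_cell r (g x) = b}" for b
  have "{x \<in> space M. infnorm (g x) \<le> Q} = (\<Union>b\<in>B. A b)"
    using grid_cell_in_grid_box[OF \<open>r > 0\<close>] by (auto simp: A_def B_def)
  then have "(prob {x \<in> space M. infnorm (g x) \<le> Q})\<^sup>2 = (prob (\<Union>b\<in>B. A b))\<^sup>2"
    by simp
  also have "\<dots> \<le> P.prob (\<Union>b\<in>B. A b \<times> A b) * card B"
    by (rule prob_UN_squared_le_prob_UN_Times) (auto simp: A_def B_def disjoint_family_on_def)
  also have "\<dots> \<le> P.prob ?near * (2 * Q / r + 2) ^ DIM('b)"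
  proof (intro mult_mono P.finite_measure_mono)
    show "(\<Union>b\<in>B. A b \<times> A b) \<subseteq> ?near"
      by (auto simp: A_def space_pair_measure
          intro!: infnorm_diff_le_if_grid_cell_eq \<open>r > 0\<close>)
    show "real (card B) \<le> (2 * Q / r + 2) ^ DIM('b)"
      unfolding B_def by (intro card_grid_box_le assms)
  qed auto
  finally show ?thesis
    using \<open>r > 0\<close> \<open>Q \<ge> 0\<close>
    by (subst pos_divide_le_eq) (auto intro!: zero_less_power add_nonneg_pos)
qed

lemma (in prob_space) prob_infnorm_difference_ge_scaled:
  fixes g :: "'a \<Rightarrow> 'b::euclidean_space"
  assumes g: "g \<in> borel_measurable M" and "0 < r" "r \<le> t" "K \<ge> 0" "e \<ge> 0"
    and concentrated: "e \<le> prob {x \<in> space M. infnorm (g x) \<le> K * t}"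
  shows "e\<^sup>2 / (2 * K + 2) ^ DIM('b) * (r / t) ^ DIM('b)
    \<le> measure (M \<Otimes>\<^sub>M M) {z \<in> space (M \<Otimes>\<^sub>M M). infnorm (g (fst z) - g (snd z)) \<le> r}"
proof -
  have "e\<^sup>2 / (2 * K + 2) ^ DIM('b) * (r / t) ^ DIM('b) = e\<^sup>2 / ((2 * K + 2) * (t / r)) ^ DIM('b)"
    by (simp add: power_mult_distrib power_divide)
  also have "\<dots> \<le> e\<^sup>2 / (2 * (K * t) / r + 2) ^ DIM('b)"
  proof (intro divide_left_mono power_mono mult_pos_pos zero_less_power)
    show "2 * (K * t) / r + 2 \<le> (2 * K + 2) * (t / r)"
      using \<open>0 < r\<close> \<open>r \<le> t\<close> by (simp add: field_simps)
    show "0 < 2 * (K * t) / r + 2"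
      using \<open>0 < r\<close> \<open>r \<le> t\<close> \<open>K \<ge> 0\<close> by (simp add: add_nonneg_pos)
  qed (use \<open>0 < r\<close> \<open>r \<le> t\<close> \<open>K \<ge> 0\<close> in auto)
  also have "\<dots> \<le> (prob {x \<in> space M. infnorm (g x) \<le> K * t})\<^sup>2 / (2 * (K * t) / r + 2) ^ DIM('b)"
    using assms by (intro divide_right_mono power_mono) simp_all
  also have "\<dots> \<le> measure (M \<Otimes>\<^sub>M M)
      {z \<in> space (M \<Otimes>\<^sub>M M). infnorm (g (fst z) - g (snd z)) \<le> r}"
    using assms by (intro prob_infnorm_difference_ge) simp_all
  finally show ?thesis .
qed

subsection \<open>Measure-preserving maps and joint ergodicity\<close>

lemma measurable_if_measure_preserving:
  "measure_preserving M T \<Longrightarrow> T \<in> M \<rightarrow>\<^sub>M M"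
  by (simp add: measure_preserving_def)

lemma measure_preserving_AE:
  assumes "measure_preserving M T" "AE x in M. P x"
  shows "AE x in M. P (T x)"
  using assms by (metis AE_distrD measure_preserving_def)

lemma measure_preserving_integral:
  fixes u :: "'a \<Rightarrow> 'b::{banach, second_countable_topology}"
  assumes "measure_preserving M T" "u \<in> borel_measurable M"
  shows "(\<integral>x. u (T x) \<partial>M) = (\<integral>x. u x \<partial>M)"
  using assms integral_distr[of T M M u] by (simp add: measure_preserving_def)

lemma measure_preserving_measure:
  assumes "measure_preserving M T" "A \<in> sets M"
  shows "measure M {x \<in> space M. T x \<in> A} = measure M A"
proof -
  have "{x \<in> space M. T x \<in> A} = T -` A \<inter> space M"
    by auto
  then show ?thesis
    using assms measure_distr[of T M M A] by (simp add: measure_preserving_def)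
qed

lemma (in prob_space) prob_le_prob_vimage_add:
  assumes T: "measure_preserving M T" and [measurable]: "A \<in> events" "D \<in> events"
  shows "prob A \<le> prob {x \<in> space M. x \<in> A \<and> T x \<in> D} + prob (space M - D)"
proof -
  have T_meas [measurable]: "T \<in> M \<rightarrow>\<^sub>M M"
    using T by (rule measurable_if_measure_preserving)
  have "prob A \<le> prob ({x \<in> space M. x \<in> A \<and> T x \<in> D} \<union> {x \<in> space M. T x \<in> space M - D})"
    using sets.sets_into_space[OF \<open>A \<in> events\<close>] measurable_space[OF T_meas]
    by (intro finite_measure_mono) auto
  also have "\<dots> \<le> prob {x \<in> space M. x \<in> A \<and> T x \<in> D} + prob {x \<in> space M. T x \<in> space M - D}"
    by (intro measure_Un_le) auto
  also have "prob {x \<in> space M. T x \<in> space M - D} = prob (space M - D)"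
    using T by (rule measure_preserving_measure) simp
  finally show ?thesis .
qed

lemma measure_preserving_id: "measure_preserving M id"
  by (simp add: measure_preserving_def id_def distr_id[unfolded id_def])

lemma measure_preserving_comp:
  assumes "measure_preserving M S" "measure_preserving M T"
  shows "measure_preserving M (S \<circ> T)"
  using assms distr_distr[of S M M T M] by (auto simp: measure_preserving_def)

lemma measure_preserving_funpow:
  assumes "measure_preserving M T"
  shows "measure_preserving M (T ^^ n)"
proof (induction n)
  case 0
  show ?case
    using measure_preserving_id by (simp add: id_def)
next
  case (Suc n)
  then show ?case
    using measure_preserving_comp[OF assms] by (simp only: funpow.simps)
qed

lemma measure_preserving_map_prod:
  assumes "sigma_finite_measure N" "measure_preserving M S" "measure_preserving N T"
  shows "measure_preserving (M \<Otimes>\<^sub>M N) (map_prod S T)"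
proof -
  have [measurable]: "S \<in> M \<rightarrow>\<^sub>M M" "T \<in> N \<rightarrow>\<^sub>M N"
    using assms by (auto simp: measure_preserving_def)
  have "distr M M S \<Otimes>\<^sub>M distr N N T = distr (M \<Otimes>\<^sub>M N) (M \<Otimes>\<^sub>M N) (\<lambda>(x, y). (S x, T y))"
    using assms by (intro pair_measure_distr) (auto simp: measure_preserving_def)
  then show ?thesis
    using assms by (simp add: measure_preserving_def map_prod_def)
qed

definition jointly_ergodic :: "'a measure \<Rightarrow> ('a \<Rightarrow> 'a) set \<Rightarrow> bool" where
  "jointly_ergodic M G \<longleftrightarrow>
     (\<forall>A\<in>sets M. (\<forall>g\<in>G. AE x in M. g x \<in> A \<longleftrightarrow> x \<in> A) \<longrightarrow>
        (AE x in M. x \<in> A) \<or> (AE x in M. x \<notin> A))"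

lemma (in prob_space) ergodic_iff_AE:
  "ergodic M T \<longleftrightarrow> (\<forall>A\<in>events. T -` A \<inter> space M = A \<longrightarrow>
     (AE x in M. x \<in> A) \<or> (AE x in M. x \<notin> A))"
  by (auto simp: ergodic_def AE_in_set_eq_1 prob_eq_0[symmetric] emeasure_eq_measure)

lemma AE_funpow_invariant:
  assumes T: "measure_preserving M T" and inv: "AE x in M. T x \<in> A \<longleftrightarrow> x \<in> A"
  shows "AE x in M. \<forall>n. (T ^^ n) x \<in> A \<longleftrightarrow> x \<in> A"
  unfolding AE_all_countable
proof
  fix n
  show "AE x in M. (T ^^ n) x \<in> A \<longleftrightarrow> x \<in> A"
  proof (induction n)
    case (Suc n)
    show ?case
      using measure_preserving_AE[OF T Suc] inv by eventually_elim (simp add: funpow_swap1)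
  qed simp
qed

text \<open>The set of points visiting \<open>A\<close> infinitely often is a strictly invariant version of \<open>A\<close>.\<close>
lemma (in prob_space) ergodic_imp_jointly_ergodic:
  assumes "measure_preserving M T" "ergodic M T"
  shows "jointly_ergodic M {T}"
  unfolding jointly_ergodic_def
proof (intro ballI impI)
  fix A
  assume [measurable]: "A \<in> events" and inv: "\<forall>g\<in>{T}. AE x in M. g x \<in> A \<longleftrightarrow> x \<in> A"
  have [measurable]: "(T ^^ n) \<in> M \<rightarrow>\<^sub>M M" for n
    using assms(1) by (intro measurable_if_measure_preserving measure_preserving_funpow)
  define B where "B = {x \<in> space M. \<forall>n. \<exists>k\<ge>n. (T ^^ k) x \<in> A}"
  have "(T ^^ k) (T x) = (T ^^ Suc k) x" for k x
    by (simp only: funpow_Suc_right comp_apply)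
  then have "(\<exists>k\<ge>n. (T ^^ k) (T x) \<in> A) \<longleftrightarrow> (\<exists>k\<ge>Suc n. (T ^^ k) x \<in> A)" for n x
    by (metis Suc_le_D Suc_le_mono)
  then have "(\<forall>n. \<exists>k\<ge>n. (T ^^ k) (T x) \<in> A) \<longleftrightarrow> (\<forall>n. \<exists>k\<ge>n. (T ^^ k) x \<in> A)" for x
    by (metis Suc_leD)
  then have "T -` B \<inter> space M = B"
    using measurable_space[OF measurable_if_measure_preserving[OF assms(1)]]
    by (auto simp: B_def)
  moreover have "B \<in> events"
    unfolding B_def by measurable
  ultimately have B_01: "(AE x in M. x \<in> B) \<or> (AE x in M. x \<notin> B)"
    using assms(2) by (simp add: ergodic_iff_AE)
  have "AE x in M. \<forall>n. (T ^^ n) x \<in> A \<longleftrightarrow> x \<in> A"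
    using inv by (intro AE_funpow_invariant assms(1)) simp
  then have "AE x in M. x \<in> B \<longleftrightarrow> x \<in> A"
    by (rule AE_mp) (auto simp: B_def)
  then have "(AE x in M. x \<in> B) \<longleftrightarrow> (AE x in M. x \<in> A)"
    and "(AE x in M. x \<notin> B) \<longleftrightarrow> (AE x in M. x \<notin> A)"
    by (intro eventually_subst; eventually_elim; simp)+
  with B_01 show "(AE x in M. x \<in> A) \<or> (AE x in M. x \<notin> A)"
    by simp
qed

lemma (in pair_prob_space) AE_section_trivial_if_invariant:
  assumes T: "measure_preserving M2 T" "ergodic M2 T" and A: "A \<in> sets (M1 \<Otimes>\<^sub>M M2)"
    and inv: "AE z in M1 \<Otimes>\<^sub>M M2. map_prod id T z \<in> A \<longleftrightarrow> z \<in> A"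
  shows "AE x in M1. (AE y in M2. (x, y) \<in> A) \<or> (AE y in M2. (x, y) \<notin> A)"
proof -
  have "AE x in M1. AE y in M2. (x, T y) \<in> A \<longleftrightarrow> (x, y) \<in> A"
    using AE_pair[OF inv] by simp
  then show ?thesis
  proof eventually_elim
    case (elim x)
    then have "\<forall>g\<in>{T}. AE y in M2. g y \<in> Pair x -` A \<longleftrightarrow> y \<in> Pair x -` A"
      by simp
    then have "(AE y in M2. y \<in> Pair x -` A) \<or> (AE y in M2. y \<notin> Pair x -` A)"
      using M2.ergodic_imp_jointly_ergodic[OF T] sets_Pair1[OF A, of x]
      unfolding jointly_ergodic_def by blast
    then show ?case
      by simp
  qed
qed

lemma (in pair_prob_space) sets_AE_section:
  assumes A: "A \<in> sets (M1 \<Otimes>\<^sub>M M2)"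
  shows "{x \<in> space M1. AE y in M2. (x, y) \<in> A} \<in> sets M1"
proof -
  have "(AE y in M2. (x, y) \<in> A) \<longleftrightarrow> emeasure M2 (Pair x -` A) = 1" for x
    using M2.AE_in_set_eq_1[OF sets_Pair1[OF A, of x]] by (simp add: M2.emeasure_eq_measure)
  moreover have "{x \<in> space M1. emeasure M2 (Pair x -` A) = 1} \<in> sets M1"
    using M2.measurable_emeasure_Pair[OF A] by measurable
  ultimately show ?thesis
    by simp
qed

lemma (in pair_prob_space) jointly_ergodic_coordinate_maps:
  assumes S: "measure_preserving M1 S" "ergodic M1 S"
    and T: "measure_preserving M2 T" "ergodic M2 T"
  shows "jointly_ergodic (M1 \<Otimes>\<^sub>M M2) {map_prod S id, map_prod id T}"
  unfolding jointly_ergodic_def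
proof (intro ballI impI)
  fix A
  assume A [measurable]: "A \<in> sets (M1 \<Otimes>\<^sub>M M2)"
    and inv: "\<forall>g\<in>{map_prod S id, map_prod id T}. AE z in M1 \<Otimes>\<^sub>M M2. g z \<in> A \<longleftrightarrow> z \<in> A"
  define full where "full = {x \<in> space M1. AE y in M2. (x, y) \<in> A}"
  have full_sets: "full \<in> sets M1"
    unfolding full_def using A by (rule sets_AE_section)
  have "AE x in M1. AE y in M2. (S x, y) \<in> A \<longleftrightarrow> (x, y) \<in> A"
    using inv AE_pair by fastforce
  then have "AE x in M1. S x \<in> full \<longleftrightarrow> x \<in> full"
    using AE_space
  proof eventually_elim
    case (elim x)
    then have "(AE y in M2. (S x, y) \<in> A) \<longleftrightarrow> (AE y in M2. (x, y) \<in> A)"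
      by (intro eventually_subst)
    then show ?case
      using measurable_space[OF measurable_if_measure_preserving[OF S(1)]] elim
      by (simp add: full_def)
  qed
  then have full_01: "(AE x in M1. x \<in> full) \<or> (AE x in M1. x \<notin> full)"
    using M1.ergodic_imp_jointly_ergodic[OF S] full_sets by (simp add: jointly_ergodic_def)
  have section_01: "AE x in M1. (AE y in M2. (x, y) \<in> A) \<or> (AE y in M2. (x, y) \<notin> A)"
    using inv by (intro AE_section_trivial_if_invariant[OF T A]) simp
  from full_01 show "(AE z in M1 \<Otimes>\<^sub>M M2. z \<in> A) \<or> (AE z in M1 \<Otimes>\<^sub>M M2. z \<notin> A)"
  proof
    assume "AE x in M1. x \<in> full"
    then have "AE x in M1. AE y in M2. (x, y) \<in> A"
      using AE_space by eventually_elim (simp add: full_def)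
    then show ?thesis
      using AE_pair_measure[of "\<lambda>z. z \<in> A"] by simp
  next
    assume "AE x in M1. x \<notin> full"
    then have "AE x in M1. AE y in M2. (x, y) \<notin> A"
      using AE_space section_01 by eventually_elim (simp add: full_def)
    then show ?thesis
      using AE_pair_measure[of "\<lambda>z. z \<notin> A"] by simp
  qed
qed

lemma (in prob_space) jointly_ergodic_imp_AE_eq_expectation:
  fixes v :: "'a \<Rightarrow> real"
  assumes "jointly_ergodic M G" and G: "\<And>g. g \<in> G \<Longrightarrow> g \<in> M \<rightarrow>\<^sub>M M"
    and v: "integrable M v" and inv: "\<And>g. g \<in> G \<Longrightarrow> AE x in M. v (g x) = v x"
  shows "AE x in M. v x = expectation v"
proof -
  note [measurable] = borel_measurable_integrable[OF v]
  define B where "B = {x \<in> space M. v x < expectation v}"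
  have "B \<in> events"
    unfolding B_def by measurable
  moreover have "AE x in M. g x \<in> B \<longleftrightarrow> x \<in> B" if g: "g \<in> G" for g
    using inv[OF g] AE_space
    by eventually_elim (use measurable_space[OF G[OF g]] in \<open>auto simp: B_def\<close>)
  ultimately have "(AE x in M. x \<in> B) \<or> (AE x in M. x \<notin> B)"
    using assms(1) by (simp add: jointly_ergodic_def)
  moreover have "\<not> (AE x in M. x \<in> B)"
    using expectation_less[OF v, of "expectation v"] by (auto simp: B_def)
  ultimately have "AE x in M. x \<notin> B"
    by blast
  then have "AE x in M. 0 \<le> v x - expectation v"
    using AE_space by eventually_elim (auto simp: B_def)
  then have "AE x in M. v x - expectation v = 0"
    using v integral_nonneg_eq_0_iff_AE[of M "\<lambda>x. v x - expectation v"] by (simp add: prob_space)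
  then show ?thesis
    by simp
qed

subsection \<open>A mean ergodic theorem by convexity\<close>

inductive_set averages :: "('z \<Rightarrow> 'z) set \<Rightarrow> ('z \<Rightarrow> real) \<Rightarrow> ('z \<Rightarrow> real) set"
  for G :: "('z \<Rightarrow> 'z) set" and w :: "'z \<Rightarrow> real" where
  base: "w \<in> averages G w"
| shift: "u \<in> averages G w \<Longrightarrow> g \<in> G \<Longrightarrow> (\<lambda>z. u (g z)) \<in> averages G w"
| midpoint: "u \<in> averages G w \<Longrightarrow> v \<in> averages G w \<Longrightarrow> (\<lambda>z. (u z + v z) / 2) \<in> averages G w"

lemma averages_in_convex:
  assumes "u \<in> averages G w" "convex K" "\<And>z. w z \<in> K"
  shows "u z \<in> K"
  using assms(1)
proof (induction arbitrary: z)
  case (midpoint u v)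
  then show ?case
    using convexD[OF \<open>convex K\<close>, of "u z" "v z" "1 / 2" "1 / 2"] by (simp add: add_divide_distrib)
qed (use assms in auto)

lemma (in prob_space) bounded_convergence:
  fixes V :: "nat \<Rightarrow> 'a \<Rightarrow> real"
  assumes "\<And>k. V k \<in> borel_measurable M" "\<And>k z. \<bar>V k z\<bar> \<le> C"
    and "v \<in> borel_measurable M" "AE z in M. (\<lambda>k. V k z) \<longlonglongrightarrow> v z"
  shows "integrable M v" "(\<lambda>k. expectation (V k)) \<longlonglongrightarrow> expectation v"
proof -
  have "AE z in M. norm (V k z) \<le> C" for k
    using assms(2) by simp
  note dominated = assms(3,1) _ assms(4) this
  show "integrable M v"
    by (rule integrable_dominated_convergence[OF dominated]) simp
  show "(\<lambda>k. expectation (V k)) \<longlonglongrightarrow> expectation v"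
    by (rule integral_dominated_convergence[OF dominated]) simp
qed

locale bounded_observable = prob_space M for M :: "'a measure" +
  fixes G :: "('a \<Rightarrow> 'a) set" and w :: "'a \<Rightarrow> real" and B :: real
  assumes measure_preserving_G: "g \<in> G \<Longrightarrow> measure_preserving M g"
    and measurable_observable: "w \<in> borel_measurable M"
    and abs_observable_le: "\<bar>w z\<bar> \<le> B"
begin

lemma borel_measurable_averages: "u \<in> averages G w \<Longrightarrow> u \<in> borel_measurable M"
proof (induction rule: averages.induct)
  case (shift u g)
  then show ?case
    using measurable_if_measure_preserving[OF measure_preserving_G] by measurable
next
  case (midpoint u v)
  then show ?case
    by measurable
qed (rule measurable_observable)

lemma abs_averages_le:
  assumes "u \<in> averages G w"
  shows "\<bar>u z\<bar> \<le> B"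
proof -
  have "w z \<in> {- B..B}" for z
    using abs_observable_le[of z] by (simp add: abs_le_iff)
  then have "u z \<in> {- B..B}"
    by (intro averages_in_convex[OF assms]) auto
  then show ?thesis
    by auto
qed

lemma integrable_averages: "u \<in> averages G w \<Longrightarrow> integrable M u"
  using borel_measurable_averages abs_averages_le by (intro integrable_const_bound[where B = B]) auto

lemma integrable_averages_power2:
  assumes "u \<in> averages G w"
  shows "integrable M (\<lambda>z. (u z)\<^sup>2)"
proof (rule integrable_const_bound[where B = "B\<^sup>2"])
  show "AE z in M. norm ((u z)\<^sup>2) \<le> B\<^sup>2"
    using abs_averages_le[OF assms] power_mono[OF _ abs_ge_zero, of _ B 2] by simp
qed (use borel_measurable_averages[OF assms] in measurable)

lemma expectation_averages: "u \<in> averages G w \<Longrightarrow> expectation u = expectation w"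
proof (induction rule: averages.induct)
  case (shift u g)
  then show ?case
    using measure_preserving_integral[OF measure_preserving_G borel_measurable_averages] by simp
next
  case (midpoint u v)
  then show ?case
    using integrable_averages by simp
qed simp

lemma averages_parallelogram:
  assumes u: "u \<in> averages G w" and v: "v \<in> averages G w"
  shows "expectation (\<lambda>z. (u z - v z)\<^sup>2) = 2 * expectation (\<lambda>z. (u z)\<^sup>2)
    + 2 * expectation (\<lambda>z. (v z)\<^sup>2) - 4 * expectation (\<lambda>z. ((u z + v z) / 2)\<^sup>2)"
proof -
  have "(u z - v z)\<^sup>2 = 2 * (u z)\<^sup>2 + 2 * (v z)\<^sup>2 - 4 * ((u z + v z) / 2)\<^sup>2" for z
    by (simp add: power2_eq_square field_simps)
  then have "expectation (\<lambda>z. (u z - v z)\<^sup>2)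
      = expectation (\<lambda>z. 2 * (u z)\<^sup>2 + 2 * (v z)\<^sup>2 - 4 * ((u z + v z) / 2)\<^sup>2)"
    by simp
  also have "\<dots> = 2 * expectation (\<lambda>z. (u z)\<^sup>2) + 2 * expectation (\<lambda>z. (v z)\<^sup>2)
      - 4 * expectation (\<lambda>z. ((u z + v z) / 2)\<^sup>2)"
    using u v averages.midpoint[OF u v] integrable_averages_power2
    by (simp del: power_divide)
  finally show ?thesis .
qed

definition min_second_moment :: real where
  "min_second_moment = (INF u\<in>averages G w. expectation (\<lambda>z. (u z)\<^sup>2))"

definition minimizing :: "(nat \<Rightarrow> 'a \<Rightarrow> real) \<Rightarrow> bool" where
  "minimizing U \<longleftrightarrow> (\<forall>k. U k \<in> averages G w) \<and>
     (\<lambda>k. expectation (\<lambda>z. (U k z)\<^sup>2)) \<longlonglongrightarrow> min_second_moment"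

lemma bdd_below_second_moments: "bdd_below ((\<lambda>u. expectation (\<lambda>z. (u z)\<^sup>2)) ` averages G w)"
  by (rule bdd_belowI[where m = 0]) auto

lemma min_second_moment_le:
  "u \<in> averages G w \<Longrightarrow> min_second_moment \<le> expectation (\<lambda>z. (u z)\<^sup>2)"
  unfolding min_second_moment_def by (rule cINF_lower[OF bdd_below_second_moments])

lemma exists_minimizing: "\<exists>U. minimizing U"
proof -
  let ?E = "(\<lambda>u. expectation (\<lambda>z. (u z)\<^sup>2)) ` averages G w"
  have "?E \<noteq> {}"
    using averages.base by blast
  then have "Inf ?E \<in> closure ?E"
    by (intro closure_contains_Inf bdd_below_second_moments)
  then obtain e where "\<And>k. e k \<in> ?E" and e: "e \<longlonglongrightarrow> Inf ?E"
    unfolding closure_sequential by blast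
  then have "\<forall>k. \<exists>u\<in>averages G w. e k = expectation (\<lambda>z. (u z)\<^sup>2)"
    by blast
  then obtain U where "\<And>k. U k \<in> averages G w" "\<And>k. e k = expectation (\<lambda>z. (U k z)\<^sup>2)"
    by metis
  moreover from this have "e = (\<lambda>k. expectation (\<lambda>z. (U k z)\<^sup>2))"
    by blast
  ultimately show ?thesis
    using e by (auto simp: minimizing_def min_second_moment_def)
qed

lemma averages_L1_dist_le:
  assumes u: "u \<in> averages G w" and v: "v \<in> averages G w"
  shows "expectation (\<lambda>z. \<bar>u z - v z\<bar>) \<le> sqrt (2 * (expectation (\<lambda>z. (u z)\<^sup>2) - min_second_moment)
    + 2 * (expectation (\<lambda>z. (v z)\<^sup>2) - min_second_moment))"
    (is "_ \<le> sqrt ?excess")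
proof (rule real_le_rsqrt)
  note [measurable] = borel_measurable_averages[OF u] borel_measurable_averages[OF v]
  have diff_le: "\<bar>u z - v z\<bar> \<le> 2 * B" for z
    using abs_averages_le[OF u, of z] abs_averages_le[OF v, of z] by linarith
  have integrable_abs: "integrable M (\<lambda>z. \<bar>u z - v z\<bar>)"
    using u v integrable_averages by simp
  have integrable_sq: "integrable M (\<lambda>z. \<bar>u z - v z\<bar>\<^sup>2)"
    using power_mono[OF diff_le abs_ge_zero, of _ 2]
    by (intro integrable_const_bound[where B = "(2 * B)\<^sup>2"]) auto
  have "(expectation (\<lambda>z. \<bar>u z - v z\<bar>))\<^sup>2 \<le> expectation (\<lambda>z. (u z - v z)\<^sup>2)"
    using variance_positive[of "\<lambda>z. \<bar>u z - v z\<bar>"] variance_eq[OF integrable_abs integrable_sq]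
    by simp
  also have "\<dots> \<le> ?excess"
    using averages_parallelogram[OF u v] min_second_moment_le[OF averages.midpoint[OF u v]] by simp
  finally show "(expectation (\<lambda>z. \<bar>u z - v z\<bar>))\<^sup>2 \<le> ?excess" .
qed

lemma minimizing_AE_convergent_subseq:
  assumes "minimizing U"
  obtains r L where "strict_mono r" "L \<in> borel_measurable M" "AE z in M. (\<lambda>k. U (r k) z) \<longlonglongrightarrow> L z"
proof -
  have U: "U k \<in> averages G w" for k
    using assms by (simp add: minimizing_def)
  note [measurable] = borel_measurable_averages[OF U]
  let ?e = "\<lambda>k. expectation (\<lambda>z. (U k z)\<^sup>2)"
  have L1_Cauchy: "\<exists>N. \<forall>i\<ge>N. \<forall>j\<ge>N. expectation (\<lambda>z. norm (U i z - U j z)) < e" if "e > 0" for e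
  proof -
    have "eventually (\<lambda>k. ?e k < min_second_moment + e\<^sup>2 / 4) sequentially"
      using assms \<open>e > 0\<close> unfolding minimizing_def by (intro order_tendstoD(2)) auto
    then obtain N where N: "\<And>k. k \<ge> N \<Longrightarrow> ?e k < min_second_moment + e\<^sup>2 / 4"
      by (auto simp: eventually_sequentially)
    have "expectation (\<lambda>z. norm (U i z - U j z)) < e" if "i \<ge> N" "j \<ge> N" for i j
    proof -
      have "sqrt (2 * (?e i - min_second_moment) + 2 * (?e j - min_second_moment)) < e"
        using N[of i] N[of j] that \<open>e > 0\<close> by (intro real_less_lsqrt) auto
      then show ?thesis
        using averages_L1_dist_le[OF U[of i] U[of j]] by simp
    qed
    then show ?thesis
      by blast
  qed
  obtain r where "strict_mono r" and Cauchy: "AE z in M. Cauchy (\<lambda>k. U (r k) z)"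
    using cauchy_L1_AE_cauchy_subseq[OF integrable_averages[OF U] L1_Cauchy] by blast
  define L where "L z = lim (\<lambda>k. U (r k) z)" for z
  have "L \<in> borel_measurable M"
    unfolding L_def by measurable
  moreover have "AE z in M. (\<lambda>k. U (r k) z) \<longlonglongrightarrow> L z"
    using Cauchy
    by eventually_elim (simp add: L_def convergent_LIMSEQ_iff[symmetric] Cauchy_convergent)
  ultimately show ?thesis
    using that \<open>strict_mono r\<close> by blast
qed

lemma minimizing_shift_L1_tendsto_0:
  assumes "minimizing U" and g: "g \<in> G"
  shows "(\<lambda>k. expectation (\<lambda>z. \<bar>U k (g z) - U k z\<bar>)) \<longlonglongrightarrow> 0"
proof (rule tendsto_sandwich)
  let ?e = "\<lambda>k. expectation (\<lambda>z. (U k z)\<^sup>2)"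
  let ?bound = "\<lambda>k. sqrt (4 * (?e k - min_second_moment))"
  have U: "U k \<in> averages G w" for k
    using assms(1) by (simp add: minimizing_def)
  note [measurable] = borel_measurable_averages[OF U]
  show "eventually (\<lambda>k. 0 \<le> expectation (\<lambda>z. \<bar>U k (g z) - U k z\<bar>)) sequentially"
    by simp
  have "expectation (\<lambda>z. (U k (g z))\<^sup>2) = ?e k" for k
    using measure_preserving_integral[OF measure_preserving_G[OF g], of "\<lambda>z. (U k z)\<^sup>2"] by simp
  then show "eventually (\<lambda>k. expectation (\<lambda>z. \<bar>U k (g z) - U k z\<bar>) \<le> ?bound k) sequentially"
    by (intro always_eventually allI
        order_trans[OF averages_L1_dist_le[OF averages.shift[OF U g] U]]) simp
  have "?bound \<longlonglongrightarrow> sqrt (4 * (min_second_moment - min_second_moment))"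
    using assms(1) unfolding minimizing_def by (intro tendsto_intros) simp
  then show "?bound \<longlonglongrightarrow> 0"
    by simp
qed simp

lemma minimizing_limit_invariant:
  assumes "minimizing U"
    and L [measurable]: "L \<in> borel_measurable M" and AE_lim: "AE z in M. (\<lambda>k. U k z) \<longlonglongrightarrow> L z"
    and g: "g \<in> G"
  shows "AE z in M. L (g z) = L z"
proof -
  have U: "U k \<in> averages G w" for k
    using assms(1) by (simp add: minimizing_def)
  have [measurable]: "U k \<in> borel_measurable M" "g \<in> M \<rightarrow>\<^sub>M M" for k
    using U g by (auto intro: borel_measurable_averages measurable_if_measure_preserving
        measure_preserving_G)
  have shift_le: "\<bar>U k (g z) - U k z\<bar> \<le> 2 * B" for k z
    using abs_averages_le[OF U, of k "g z"] abs_averages_le[OF U, of k z] by linarith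
  have "AE z in M. (\<lambda>k. U k (g z)) \<longlonglongrightarrow> L (g z)"
    using measure_preserving_G[OF g] AE_lim by (rule measure_preserving_AE)
  then have shift_lim: "AE z in M. (\<lambda>k. \<bar>U k (g z) - U k z\<bar>) \<longlonglongrightarrow> \<bar>L (g z) - L z\<bar>"
    using AE_lim by eventually_elim (intro tendsto_intros)
  note bounded_convergence_shift = bounded_convergence[where C = "2 * B", OF _ _ _ shift_lim]
  have integrable_abs: "integrable M (\<lambda>z. \<bar>L (g z) - L z\<bar>)"
    by (rule bounded_convergence_shift) (simp_all add: shift_le)
  have "(\<lambda>k. expectation (\<lambda>z. \<bar>U k (g z) - U k z\<bar>)) \<longlonglongrightarrow> expectation (\<lambda>z. \<bar>L (g z) - L z\<bar>)"
    by (rule bounded_convergence_shift) (simp_all add: shift_le)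
  then have "expectation (\<lambda>z. \<bar>L (g z) - L z\<bar>) = 0"
    using minimizing_shift_L1_tendsto_0[OF assms(1) g] by (rule LIMSEQ_unique)
  then show ?thesis
    using integrable_abs by (simp add: integral_nonneg_eq_0_iff_AE)
qed

text \<open>Von Neumann's theorem: averages of minimal second moment form a Cauchy sequence by the
  parallelogram law, and their limit is invariant since a shift preserves the second moment.\<close>
theorem averages_L1_tendsto_expectation:
  assumes "jointly_ergodic M G"
  obtains U where "\<And>k. U k \<in> averages G w"
    and "(\<lambda>k. expectation (\<lambda>z. \<bar>U k z - expectation w\<bar>)) \<longlonglongrightarrow> 0"
proof -
  obtain V where "minimizing V"
    using exists_minimizing by blast
  then obtain r L where r: "strict_mono r" and L [measurable]: "L \<in> borel_measurable M"
    and AE_lim: "AE z in M. (\<lambda>k. V (r k) z) \<longlonglongrightarrow> L z"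
    by (rule minimizing_AE_convergent_subseq)
  have minimizing_subseq: "minimizing (\<lambda>k. V (r k))"
    using \<open>minimizing V\<close> LIMSEQ_subseq_LIMSEQ[OF _ r] by (fastforce simp: minimizing_def comp_def)
  then have Vr: "V (r k) \<in> averages G w" for k
    by (simp add: minimizing_def)
  note [measurable] = borel_measurable_averages[OF Vr]
  have "AE z in M. L (g z) = L z" if "g \<in> G" for g
    using minimizing_subseq L AE_lim that by (rule minimizing_limit_invariant)
  moreover have "integrable M L" and to_L: "(\<lambda>k. expectation (V (r k))) \<longlonglongrightarrow> expectation L"
    using bounded_convergence[OF _ abs_averages_le[OF Vr] L AE_lim] by simp_all
  ultimately have "AE z in M. L z = expectation L"
    using assms measurable_if_measure_preserving[OF measure_preserving_G]
    by (intro jointly_ergodic_imp_AE_eq_expectation)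
  moreover have "expectation L = expectation w"
    using to_L by (simp add: expectation_averages[OF Vr] LIMSEQ_const_iff)
  ultimately have "AE z in M. L z = expectation w"
    by simp
  then have "AE z in M. (\<lambda>k. \<bar>V (r k) z - expectation w\<bar>) \<longlonglongrightarrow> 0"
    using AE_lim by eventually_elim (simp add: LIM_zero tendsto_rabs_zero)
  moreover have "\<bar>V (r k) z - expectation w\<bar> \<le> B + \<bar>expectation w\<bar>" for k z
    using abs_averages_le[OF Vr, of k z] by linarith
  ultimately have "(\<lambda>k. expectation (\<lambda>z. \<bar>V (r k) z - expectation w\<bar>)) \<longlonglongrightarrow> expectation (\<lambda>_. 0)"
    by (intro bounded_convergence(2)) auto
  with Vr show ?thesis
    by (intro that[of "\<lambda>k. V (r k)"]) simp_all
qed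

corollary exists_averages_concentrated:
  assumes "jointly_ergodic M G" "h < expectation w" "e > 0"
  obtains u where "u \<in> averages G w" "prob {z \<in> space M. u z < h} < e"
proof -
  define \<delta> where "\<delta> = expectation w - h"
  have "\<delta> > 0"
    using assms by (simp add: \<delta>_def)
  obtain U where U: "\<And>k. U k \<in> averages G w"
    and lim: "(\<lambda>k. expectation (\<lambda>z. \<bar>U k z - expectation w\<bar>)) \<longlonglongrightarrow> 0"
    using averages_L1_tendsto_expectation[OF assms(1)] by blast
  have "eventually (\<lambda>k. expectation (\<lambda>z. \<bar>U k z - expectation w\<bar>) < e * \<delta>) sequentially"
    using lim \<open>e > 0\<close> \<open>\<delta> > 0\<close> by (intro order_tendstoD) auto
  then obtain k where k: "expectation (\<lambda>z. \<bar>U k z - expectation w\<bar>) < e * \<delta>"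
    using eventually_happens'[OF sequentially_bot] by blast
  note [measurable] = borel_measurable_averages[OF U]
  have "prob {z \<in> space M. U k z < h} \<le> prob {z \<in> space M. \<bar>U k z - expectation w\<bar> \<ge> \<delta>}"
    by (intro finite_measure_mono) (auto simp: \<delta>_def)
  also have "\<dots> \<le> expectation (\<lambda>z. \<bar>U k z - expectation w\<bar>) / \<delta>"
    using integrable_averages[OF U] \<open>\<delta> > 0\<close>
    by (intro integral_Markov_inequality_measure[where A = "space M"]) auto
  also have "\<dots> < e"
    using k \<open>\<delta> > 0\<close> by (simp add: pos_divide_less_eq)
  finally show ?thesis
    using that U by blast
qed

end

subsection \<open>Cocycles and lower limits\<close>

lemma cocycle_add:
  "cocycle T f (m + n) x = cocycle T f n x + cocycle T f m ((T ^^ n) x)"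
  by (induction m) (auto simp: cocycle_def funpow_add add.assoc)

lemma borel_measurable_cocycle:
  fixes f :: "'a \<Rightarrow> 'b::{second_countable_topology, real_normed_vector}"
  assumes "measure_preserving M T" and [measurable]: "f \<in> borel_measurable M"
  shows "cocycle T f n \<in> borel_measurable M"
proof -
  note [measurable] = measurable_if_measure_preserving[OF measure_preserving_funpow[OF assms(1)]]
  show ?thesis
    unfolding cocycle_def by measurable
qed

lemma funpow_commute_apply:
  assumes "\<And>z. S (g z) = g (S z)"
  shows "(S ^^ n) (g z) = g ((S ^^ n) z)"
  by (induction n) (simp_all add: assms)

lemma cocycle_cohomologous:
  fixes f :: "'a \<Rightarrow> 'b::ab_group_add"
  assumes commute: "\<And>z. S (g z) = g (S z)" and "\<And>z. f (g z) = f z + p (S z) - p z"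
  shows "cocycle S f n (g z) = cocycle S f n z + p ((S ^^ n) z) - p z"
  by (induction n) (simp_all add: cocycle_def funpow_commute_apply[of S g, OF commute] assms(2))

lemma funpow_map_prod:
  fixes S :: "'a \<Rightarrow> 'a" and T :: "'b \<Rightarrow> 'b"
  shows "(map_prod S T ^^ n) z = ((S ^^ n) (fst z), (T ^^ n) (snd z))"
  by (induction n) auto

lemma cocycle_map_prod_difference:
  "cocycle (map_prod T T) (\<lambda>(x, y). f x - f y) n z
    = cocycle T f n (fst z) - (cocycle T f n (snd z) :: 'b::ab_group_add)"
  by (simp add: cocycle_def funpow_map_prod sum_subtractf)

lemma (in prob_space) exists_prob_gt_less:
  fixes X :: "'a \<Rightarrow> real"
  assumes [measurable]: "X \<in> borel_measurable M" and "e > 0"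
  obtains R where "R \<ge> 0" "prob {z \<in> space M. X z > R} < e"
proof -
  have "(\<lambda>k::nat. prob {z \<in> space M. X z > real k}) \<longlonglongrightarrow> prob (\<Inter>k::nat. {z \<in> space M. X z > real k})"
    by (rule finite_Lim_measure_decseq) (auto simp: decseq_def)
  moreover have "(\<Inter>k::nat. {z \<in> space M. X z > real k}) = {}"
    by (auto, meson not_less real_arch_simple)
  ultimately have "eventually (\<lambda>k::nat. prob {z \<in> space M. X z > real k} < e) sequentially"
    using \<open>e > 0\<close> by (simp add: order_tendstoD)
  then obtain k :: nat where "prob {z \<in> space M. X z > real k} < e"
    using eventually_happens'[OF sequentially_bot] by blast
  then show ?thesis
    by (intro that[of "real k"]) simp
qed

lemma liminf_eq_0_if_frequently_small:
  fixes a :: "nat \<Rightarrow> real"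
  assumes nonneg: "\<And>n. 0 \<le> a n" and small: "\<And>N k. \<exists>n\<ge>N. a n \<le> 1 / real (Suc k)"
  shows "liminf (\<lambda>n. ereal (a n)) = 0"
proof (rule antisym)
  show "0 \<le> liminf (\<lambda>n. ereal (a n))"
    using nonneg by (intro Liminf_bounded) simp
  show "liminf (\<lambda>n. ereal (a n)) \<le> 0"
  proof (rule ccontr)
    assume "\<not> liminf (\<lambda>n. ereal (a n)) \<le> 0"
    then obtain s where s: "0 < ereal s" "ereal s < liminf (\<lambda>n. ereal (a n))"
      using ereal_dense2[of 0 "liminf (\<lambda>n. ereal (a n))"] by (auto simp: not_le)
    then obtain N where N: "\<And>n. n \<ge> N \<Longrightarrow> s < a n"
      using less_LiminfD[OF s(2)] by (auto simp: eventually_sequentially)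
    obtain k where "1 / real (Suc k) < s"
      using s(1) nat_approx_posE[of s] by auto
    then show False
      using small[of N k] N by fastforce
  qed
qed

lemma (in prob_space) AE_liminf_eq_0I:
  fixes X :: "nat \<Rightarrow> 'a \<Rightarrow> real"
  assumes [measurable]: "\<And>n. X n \<in> borel_measurable M" and nonneg: "\<And>n z. 0 \<le> X n z"
    and escape: "\<And>s N. s > 0 \<Longrightarrow> prob {z \<in> space M. \<forall>n\<ge>N. X n z > s} = 0"
  shows "AE z in M. liminf (\<lambda>n. ereal (X n z)) = 0"
proof -
  have "AE z in M. \<exists>n\<ge>N. X n z \<le> 1 / real (Suc k)" for N k
  proof -
    define C where "C = {z \<in> space M. \<forall>n\<ge>N. X n z > 1 / real (Suc k)}"
    have "C \<in> events"
      unfolding C_def by measurable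
    moreover have "prob C = 0"
      unfolding C_def by (rule escape) simp
    ultimately have "AE z in M. z \<notin> C"
      by (simp add: prob_eq_0)
    then show ?thesis
      using AE_space by eventually_elim (auto simp: C_def not_less)
  qed
  then have "AE z in M. \<forall>N k. \<exists>n\<ge>N. X n z \<le> 1 / real (Suc k)"
    unfolding AE_all_countable by blast
  then show ?thesis
    by eventually_elim (rule liminf_eq_0_if_frequently_small[OF nonneg], blast)
qed

subsection \<open>Counting visits\<close>

locale cohomology_invariant_cocycle = prob_space M for M :: "'a measure" +
  fixes S :: "'a \<Rightarrow> 'a" and \<phi> :: "'a \<Rightarrow> 'b::euclidean_space" and G :: "('a \<Rightarrow> 'a) set"
  assumes measure_preserving_S: "measure_preserving M S"
    and measurable_\<phi>: "\<phi> \<in> borel_measurable M"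
    and measure_preserving_G: "g \<in> G \<Longrightarrow> measure_preserving M g"
    and jointly_ergodic_G: "jointly_ergodic M G"
    and commute: "g \<in> G \<Longrightarrow> S (g z) = g (S z)"
    and cohomologous: "g \<in> G \<Longrightarrow> \<exists>p\<in>borel_measurable M. \<forall>z. \<phi> (g z) = \<phi> z + p (S z) - p z"
begin

abbreviation F :: "nat \<Rightarrow> 'a \<Rightarrow> 'b" where
  "F \<equiv> cocycle S \<phi>"

lemma borel_measurable_F [measurable]: "F n \<in> borel_measurable M"
  by (intro borel_measurable_cocycle measure_preserving_S measurable_\<phi>)

definition weighted_visits :: "nat set \<Rightarrow> 'b \<Rightarrow> real \<Rightarrow> ('a \<Rightarrow> real) \<Rightarrow> 'a \<Rightarrow> real" where
  "weighted_visits J q r v z = (\<Sum>n\<in>J. of_bool (infnorm (F n z - q) \<le> r) * v ((S ^^ n) z))"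

definition visits_bounded_on :: "'a set \<Rightarrow> real \<Rightarrow> real \<Rightarrow> ('a \<Rightarrow> real) \<Rightarrow> bool" where
  "visits_bounded_on D R c u \<longleftrightarrow> (\<forall>J q r z. finite J \<longrightarrow> r \<ge> 0 \<longrightarrow>
     weighted_visits J q r (\<lambda>z. indicator D z * u z) z \<le> c * (r + R) ^ DIM('b))"

definition visits_bounded :: "real \<Rightarrow> ('a \<Rightarrow> real) \<Rightarrow> bool" where
  "visits_bounded c u \<longleftrightarrow>
     (\<forall>e>0. \<exists>D\<in>events. \<exists>R\<ge>0. prob (space M - D) < e \<and> visits_bounded_on D R c u)"

lemma visits_boundedI:
  assumes "\<And>e. e > 0 \<Longrightarrow> \<exists>D\<in>events. \<exists>R\<ge>0. prob (space M - D) < e \<and> visits_bounded_on D R c u"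
  shows "visits_bounded c u"
  using assms by (simp add: visits_bounded_def)

lemma visits_boundedE:
  assumes "visits_bounded c u" "e > 0"
  obtains D R where "D \<in> events" "R \<ge> 0" "prob (space M - D) < e" "visits_bounded_on D R c u"
  using assms unfolding visits_bounded_def by blast

lemma visits_bounded_onD:
  "visits_bounded_on D R c u \<Longrightarrow> finite J \<Longrightarrow> r \<ge> 0 \<Longrightarrow>
    weighted_visits J q r (\<lambda>z. indicator D z * u z) z \<le> c * (r + R) ^ DIM('b)"
  unfolding visits_bounded_on_def by blast

lemma visits_bounded_on_imp_nonneg:
  assumes "visits_bounded_on D R c u" "R \<ge> 0"
  shows "0 \<le> c"
proof -
  have "0 \<le> c * (1 + R) ^ DIM('b)"
    using visits_bounded_onD[OF assms(1), of "{}" 1] by (simp add: weighted_visits_def)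
  moreover have "0 < (1 + R) ^ DIM('b)"
    using \<open>R \<ge> 0\<close> by simp
  ultimately show ?thesis
    by (simp add: zero_le_mult_iff)
qed

lemma visits_bounded_imp_nonneg:
  assumes "visits_bounded c u"
  shows "0 \<le> c"
  using assms zero_less_one by (rule visits_boundedE) (rule visits_bounded_on_imp_nonneg)

lemma weighted_visits_mono:
  "(\<And>z. u z \<le> v z) \<Longrightarrow> weighted_visits J q r u z \<le> weighted_visits J q r v z"
  unfolding weighted_visits_def by (intro sum_mono mult_left_mono) auto

lemma weighted_visits_add:
  "weighted_visits J q r (\<lambda>z. u z + v z) z = weighted_visits J q r u z + weighted_visits J q r v z"
  by (simp add: weighted_visits_def distrib_left sum.distrib)

lemma weighted_visits_cmult:
  "weighted_visits J q r (\<lambda>z. a * u z) z = a * weighted_visits J q r u z"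
  by (simp add: weighted_visits_def sum_distrib_left mult.left_commute)

lemma weighted_visits_shift_le:
  assumes g: "g \<in> G" and p: "\<And>z. \<phi> (g z) = \<phi> z + p (S z) - p z" and nonneg: "\<And>z. 0 \<le> v z"
  shows "weighted_visits J q r (\<lambda>z. of_bool (infnorm (p z) \<le> R) * v (g z)) z
    \<le> weighted_visits J (q - p z) (r + R) v (g z)"
  unfolding weighted_visits_def
proof (rule sum_mono)
  fix n
  have "F n (g z) - (q - p z) = (F n z - q) + p ((S ^^ n) z)"
    using cocycle_cohomologous[of S g \<phi> p, OF commute[OF g] p] by simp
  then have "infnorm (F n (g z) - (q - p z)) \<le> infnorm (F n z - q) + infnorm (p ((S ^^ n) z))"
    by (metis infnorm_triangle)
  then show "of_bool (infnorm (F n z - q) \<le> r)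
        * (of_bool (infnorm (p ((S ^^ n) z)) \<le> R) * v (g ((S ^^ n) z)))
      \<le> of_bool (infnorm (F n (g z) - (q - p z)) \<le> r + R) * v ((S ^^ n) (g z))"
    using nonneg by (auto simp: funpow_commute_apply[of S g, OF commute[OF g]])
qed

lemma visits_bounded_on_indicator:
  assumes "s > 0" and escape: "\<And>n z. z \<in> C \<Longrightarrow> n \<ge> N \<Longrightarrow> infnorm (F n z) > s"
  shows "visits_bounded_on D s (real N * (2 / s) ^ DIM('b)) (indicator C)"
  unfolding visits_bounded_on_def
proof (intro allI impI)
  fix J :: "nat set" and q z and r :: real
  assume "finite J" "r \<ge> 0"
  define V where "V = {n \<in> J. infnorm (F n z - q) \<le> r \<and> (S ^^ n) z \<in> C}"
  have "weighted_visits J q r (\<lambda>z. indicator D z * indicator C z) z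
      \<le> weighted_visits J q r (indicator C) z"
    by (intro weighted_visits_mono) (simp add: indicator_def)
  also have "\<dots> = (\<Sum>n\<in>J. if n \<in> V then 1 else 0)"
    unfolding weighted_visits_def by (intro sum.cong) (auto simp: V_def)
  also have "\<dots> = (\<Sum>n\<in>V. 1)"
    using \<open>finite J\<close> by (intro sum.mono_neutral_cong_right) (auto simp: V_def)
  also have "\<dots> = real (card V)"
    by simp
  also have "\<dots> \<le> real N * (2 * r / s + 2) ^ DIM('b)"
  proof (rule card_separated_le)
    fix m n
    assume mn: "m \<in> V" "n \<in> V" "m + N \<le> n"
    have "F n z - F m z = F (n - m) ((S ^^ m) z)"
      using cocycle_add[of S \<phi> "n - m" m z] mn by simp
    then show "infnorm (F n z - F m z) > s"
      using escape[of "(S ^^ m) z" "n - m"] mn by (simp add: V_def)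
  qed (use \<open>finite J\<close> \<open>s > 0\<close> \<open>r \<ge> 0\<close> in \<open>auto simp: V_def\<close>)
  also have "2 * r / s + 2 = 2 / s * (r + s)"
    using \<open>s > 0\<close> by (simp add: field_simps)
  finally show "weighted_visits J q r (\<lambda>z. indicator D z * indicator C z) z
      \<le> real N * (2 / s) ^ DIM('b) * (r + s) ^ DIM('b)"
    by (simp only: power_mult_distrib mult.assoc)
qed

lemma visits_bounded_on_shift:
  assumes u: "visits_bounded_on D R c u" "\<And>z. 0 \<le> u z" and g: "g \<in> G"
    and p: "\<And>z. \<phi> (g z) = \<phi> z + p (S z) - p z" and "R' \<ge> 0"
  shows "visits_bounded_on {z \<in> space M. g z \<in> D \<and> infnorm (p z) \<le> R'} (R' + R) c (\<lambda>z. u (g z))"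
    (is "visits_bounded_on ?D _ _ _")
  unfolding visits_bounded_on_def
proof (intro allI impI)
  fix J :: "nat set" and q z and r :: real
  assume "finite J" "r \<ge> 0"
  have "weighted_visits J q r (\<lambda>z. indicator ?D z * u (g z)) z
      \<le> weighted_visits J q r (\<lambda>z. of_bool (infnorm (p z) \<le> R') * (indicator D (g z) * u (g z))) z"
    using u(2) by (intro weighted_visits_mono) (simp add: indicator_def)
  also have "\<dots> \<le> weighted_visits J (q - p z) (r + R') (\<lambda>z. indicator D z * u z) (g z)"
    using u(2) by (intro weighted_visits_shift_le[OF g p]) simp
  also have "\<dots> \<le> c * (r + R' + R) ^ DIM('b)"
    using \<open>finite J\<close> \<open>r \<ge> 0\<close> \<open>R' \<ge> 0\<close> by (intro visits_bounded_onD[OF u(1)]) simp_all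
  finally show "weighted_visits J q r (\<lambda>z. indicator ?D z * u (g z)) z
      \<le> c * (r + (R' + R)) ^ DIM('b)"
    by (simp add: add.assoc)
qed

lemma visits_bounded_on_midpoint:
  assumes u: "visits_bounded_on D1 R1 c u" "\<And>z. 0 \<le> u z"
    and v: "visits_bounded_on D2 R2 c v" "\<And>z. 0 \<le> v z"
    and "R1 \<ge> 0" "R2 \<ge> 0"
  shows "visits_bounded_on (D1 \<inter> D2) (max R1 R2) c (\<lambda>z. (u z + v z) / 2)"
  unfolding visits_bounded_on_def
proof (intro allI impI)
  fix J :: "nat set" and q z and r :: real
  assume "finite J" "r \<ge> 0"
  have "0 \<le> c"
    using u(1) \<open>R1 \<ge> 0\<close> by (rule visits_bounded_on_imp_nonneg)
  then have c_mono: "c * (r + R) ^ DIM('b) \<le> c * (r + max R1 R2) ^ DIM('b)" if "R \<in> {R1, R2}" for R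
    using that \<open>r \<ge> 0\<close> \<open>R1 \<ge> 0\<close> \<open>R2 \<ge> 0\<close> by (intro mult_left_mono power_mono) auto
  have "weighted_visits J q r (\<lambda>z. indicator (D1 \<inter> D2) z * ((u z + v z) / 2)) z
      \<le> weighted_visits J q r (\<lambda>z. 1 / 2 * (indicator D1 z * u z + indicator D2 z * v z)) z"
    using u(2) v(2) by (intro weighted_visits_mono) (simp add: indicator_def)
  also have "\<dots> = 1 / 2 * (weighted_visits J q r (\<lambda>z. indicator D1 z * u z) z
      + weighted_visits J q r (\<lambda>z. indicator D2 z * v z) z)"
    by (simp only: weighted_visits_cmult weighted_visits_add)
  also have "\<dots> \<le> 1 / 2 * (c * (r + R1) ^ DIM('b) + c * (r + R2) ^ DIM('b))"
    using \<open>finite J\<close> \<open>r \<ge> 0\<close>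
    by (intro mult_left_mono add_mono visits_bounded_onD[OF u(1)] visits_bounded_onD[OF v(1)]) auto
  also have "\<dots> \<le> c * (r + max R1 R2) ^ DIM('b)"
    using c_mono[of R1] c_mono[of R2] by simp
  finally show "weighted_visits J q r (\<lambda>z. indicator (D1 \<inter> D2) z * ((u z + v z) / 2)) z
      \<le> c * (r + max R1 R2) ^ DIM('b)" .
qed

lemma visits_bounded_on_superlevel:
  assumes u: "visits_bounded_on D R c u" "\<And>z. 0 \<le> u z" and "h > 0"
  shows "visits_bounded_on {z \<in> D. h \<le> u z} R (c / h) (\<lambda>_. 1)"
  unfolding visits_bounded_on_def
proof (intro allI impI)
  fix J :: "nat set" and q z and r :: real
  assume "finite J" "r \<ge> 0"
  have "weighted_visits J q r (\<lambda>z. indicator {z \<in> D. h \<le> u z} z * 1) z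
      \<le> weighted_visits J q r (\<lambda>z. 1 / h * (indicator D z * u z)) z"
    using \<open>h > 0\<close> u(2) by (intro weighted_visits_mono) (simp add: indicator_def)
  also have "\<dots> \<le> 1 / h * (c * (r + R) ^ DIM('b))"
    unfolding weighted_visits_cmult using \<open>h > 0\<close> \<open>finite J\<close> \<open>r \<ge> 0\<close>
    by (intro mult_left_mono visits_bounded_onD[OF u(1)]) simp_all
  finally show "weighted_visits J q r (\<lambda>z. indicator {z \<in> D. h \<le> u z} z * 1) z
      \<le> c / h * (r + R) ^ DIM('b)"
    by simp
qed

lemma visits_bounded_indicator:
  assumes "s > 0" "\<And>n z. z \<in> C \<Longrightarrow> n \<ge> N \<Longrightarrow> infnorm (F n z) > s"
  shows "visits_bounded (real N * (2 / s) ^ DIM('b)) (indicator C)"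
proof (rule visits_boundedI, intro bexI exI conjI)
  show "visits_bounded_on (space M) s (real N * (2 / s) ^ DIM('b)) (indicator C)"
    using assms by (rule visits_bounded_on_indicator)
qed (use \<open>s > 0\<close> in auto)

lemma visits_bounded_shift:
  assumes u: "visits_bounded c u" "\<And>z. 0 \<le> u z" and g: "g \<in> G"
  shows "visits_bounded c (\<lambda>z. u (g z))"
proof (rule visits_boundedI)
  fix e :: real
  assume "e > 0"
  then have "e / 2 > 0"
    by simp
  have [measurable]: "g \<in> M \<rightarrow>\<^sub>M M"
    using g by (intro measurable_if_measure_preserving measure_preserving_G)
  obtain p where [measurable]: "p \<in> borel_measurable M" and p: "\<And>z. \<phi> (g z) = \<phi> z + p (S z) - p z"
    using cohomologous[OF g] by blast
  obtain D R where [measurable]: "D \<in> events" and "R \<ge> 0" and D_large: "prob (space M - D) < e / 2"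
    and D: "visits_bounded_on D R c u"
    using u(1) \<open>e / 2 > 0\<close> by (rule visits_boundedE)
  obtain R' where "R' \<ge> 0" and p_tight: "prob {z \<in> space M. infnorm (p z) > R'} < e / 2"
    using exists_prob_gt_less[of "\<lambda>z. infnorm (p z)", OF _ \<open>e / 2 > 0\<close>] by auto
  define D' where "D' = {z \<in> space M. g z \<in> D \<and> infnorm (p z) \<le> R'}"
  have [measurable]: "D' \<in> events"
    unfolding D'_def by measurable
  have "prob {z \<in> space M. infnorm (p z) \<le> R'} \<le> prob D' + prob (space M - D)"
    using prob_le_prob_vimage_add[OF measure_preserving_G[OF g],
        of "{z \<in> space M. infnorm (p z) \<le> R'}" D]
    by (simp add: D'_def conj_commute cong: conj_cong)
  moreover have "prob {z \<in> space M. infnorm (p z) \<le> R'}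
      = 1 - prob {z \<in> space M. infnorm (p z) > R'}"
    by (subst prob_compl[symmetric]) (auto intro!: arg_cong[where f = prob])
  ultimately have "prob (space M - D') < e"
    using D_large p_tight by (simp add: prob_compl)
  moreover have "visits_bounded_on D' (R' + R) c (\<lambda>z. u (g z))"
    unfolding D'_def using D u(2) g p \<open>R' \<ge> 0\<close> by (rule visits_bounded_on_shift)
  moreover have "R' + R \<ge> 0"
    using \<open>R \<ge> 0\<close> \<open>R' \<ge> 0\<close> by simp
  ultimately show "\<exists>D\<in>events. \<exists>R\<ge>0. prob (space M - D) < e
      \<and> visits_bounded_on D R c (\<lambda>z. u (g z))"
    using \<open>D' \<in> events\<close> by blast
qed

lemma visits_bounded_midpoint:
  assumes u: "visits_bounded c u" "\<And>z. 0 \<le> u z" and v: "visits_bounded c v" "\<And>z. 0 \<le> v z"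
  shows "visits_bounded c (\<lambda>z. (u z + v z) / 2)"
proof (rule visits_boundedI)
  fix e :: real
  assume "e > 0"
  then have "e / 2 > 0"
    by simp
  obtain D1 R1 where [measurable]: "D1 \<in> events" and "R1 \<ge> 0"
    and D1_large: "prob (space M - D1) < e / 2" and D1: "visits_bounded_on D1 R1 c u"
    using u(1) \<open>e / 2 > 0\<close> by (rule visits_boundedE)
  obtain D2 R2 where [measurable]: "D2 \<in> events" and "R2 \<ge> 0"
    and D2_large: "prob (space M - D2) < e / 2" and D2: "visits_bounded_on D2 R2 c v"
    using v(1) \<open>e / 2 > 0\<close> by (rule visits_boundedE)
  have "prob (space M - D1 \<inter> D2) \<le> prob (space M - D1) + prob (space M - D2)"
    unfolding Diff_Int by (intro measure_Un_le) auto
  then have "prob (space M - D1 \<inter> D2) < e"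
    using D1_large D2_large by linarith
  moreover have "visits_bounded_on (D1 \<inter> D2) (max R1 R2) c (\<lambda>z. (u z + v z) / 2)"
    using D1 u(2) D2 v(2) \<open>R1 \<ge> 0\<close> \<open>R2 \<ge> 0\<close> by (rule visits_bounded_on_midpoint)
  moreover have "D1 \<inter> D2 \<in> events" "max R1 R2 \<ge> 0"
    using \<open>R1 \<ge> 0\<close> by auto
  ultimately show "\<exists>D\<in>events. \<exists>R\<ge>0. prob (space M - D) < e
      \<and> visits_bounded_on D R c (\<lambda>z. (u z + v z) / 2)"
    by blast
qed

lemma visits_bounded_averages:
  assumes "u \<in> averages G w" "visits_bounded c w" and nonneg: "\<And>z. 0 \<le> w z"
  shows "visits_bounded c u"
proof -
  have averages_nonneg: "0 \<le> v z" if "v \<in> averages G w" for v z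
    using averages_in_convex[OF that, of "{0..}"] nonneg by simp
  show ?thesis
    using assms(1)
  proof (induction rule: averages.induct)
    case (shift u g)
    show ?case
      using shift.IH averages_nonneg[OF shift.hyps(1)] shift.hyps(2) by (rule visits_bounded_shift)
  next
    case (midpoint u v)
    show ?case
      using midpoint.IH(1) averages_nonneg[OF midpoint.hyps(1)]
        midpoint.IH(2) averages_nonneg[OF midpoint.hyps(2)] by (rule visits_bounded_midpoint)
  qed (fact assms(2))
qed

text \<open>The constant does not depend on the measure of the exceptional set, although the number of
  shifts in the average of \<open>w\<close> does.\<close>
lemma visits_bounded_1:
  assumes "visits_bounded c w" and w [measurable]: "w \<in> borel_measurable M"
    and w01: "\<And>z. 0 \<le> w z" "\<And>z. w z \<le> 1" and "expectation w > 0"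
  shows "visits_bounded (2 * c / expectation w) (\<lambda>_. 1)"
proof (rule visits_boundedI)
  interpret bounded_observable M G w 1
    using w w01 measure_preserving_G by unfold_locales (auto simp: abs_le_iff intro: order_trans)
  define h where "h = expectation w / 2"
  have h: "h > 0" "h < expectation w"
    using \<open>expectation w > 0\<close> by (simp_all add: h_def)
  fix e :: real
  assume "e > 0"
  then have "e / 2 > 0"
    by simp
  obtain u where u: "u \<in> averages G w" and u_small: "prob {z \<in> space M. u z < h} < e / 2"
    using jointly_ergodic_G h(2) \<open>e / 2 > 0\<close> by (rule exists_averages_concentrated)
  note [measurable] = borel_measurable_averages[OF u]
  have u_nonneg: "0 \<le> u z" for z
    using averages_in_convex[OF u, of "{0..}"] w01 by simp
  obtain D R where [measurable]: "D \<in> events" and "R \<ge> 0" and D_large: "prob (space M - D) < e / 2"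
    and D: "visits_bounded_on D R c u"
    using visits_bounded_averages[OF u assms(1) w01(1)] \<open>e / 2 > 0\<close> by (rule visits_boundedE)
  define D' where "D' = {z \<in> D. h \<le> u z}"
  have "D' = {z \<in> space M. z \<in> D \<and> h \<le> u z}"
    using sets.sets_into_space[OF \<open>D \<in> events\<close>] by (auto simp: D'_def)
  then have [measurable]: "D' \<in> events"
    by simp
  have "prob (space M - D') \<le> prob ((space M - D) \<union> {z \<in> space M. u z < h})"
    by (intro finite_measure_mono) (auto simp: D'_def)
  also have "\<dots> \<le> prob (space M - D) + prob {z \<in> space M. u z < h}"
    by (intro measure_Un_le) auto
  finally have "prob (space M - D') < e"
    using D_large u_small by linarith
  moreover have "visits_bounded_on D' R (c / h) (\<lambda>_. 1)"
    unfolding D'_def using D u_nonneg h(1) by (rule visits_bounded_on_superlevel)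
  ultimately show "\<exists>D\<in>events. \<exists>R\<ge>0. prob (space M - D) < e
      \<and> visits_bounded_on D R (2 * c / expectation w) (\<lambda>_. 1)"
    using \<open>D' \<in> events\<close> \<open>R \<ge> 0\<close> by (auto simp: h_def mult.commute)
qed

lemma sum_prob_le_if_visits_bounded:
  assumes "visits_bounded c (\<lambda>_. 1)" "e > 0"
  obtains R where "R \<ge> 0" and "\<And>J r. finite J \<Longrightarrow> r \<ge> 0 \<Longrightarrow>
    (\<Sum>n\<in>J. prob {z \<in> space M. infnorm (F n z) \<le> r} - e) \<le> c * (r + R) ^ DIM('b)"
proof -
  obtain D R where [measurable]: "D \<in> events" and "R \<ge> 0" and D_large: "prob (space M - D) < e"
    and D: "visits_bounded_on D R c (\<lambda>_. 1)"
    using assms by (rule visits_boundedE)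
  have [measurable]: "(S ^^ n) \<in> M \<rightarrow>\<^sub>M M" for n
    by (intro measurable_if_measure_preserving measure_preserving_funpow measure_preserving_S)
  have "(\<Sum>n\<in>J. prob {z \<in> space M. infnorm (F n z) \<le> r} - e) \<le> c * (r + R) ^ DIM('b)"
    if "finite J" "r \<ge> 0" for J r
  proof -
    define A where "A n = {z \<in> space M. infnorm (F n z) \<le> r \<and> (S ^^ n) z \<in> D}" for n
    have [measurable]: "A n \<in> events" for n
      unfolding A_def by measurable
    have "prob {z \<in> space M. infnorm (F n z) \<le> r} - e \<le> prob (A n)" for n
      using prob_le_prob_vimage_add[OF measure_preserving_funpow[OF measure_preserving_S],
          of "{z \<in> space M. infnorm (F n z) \<le> r}" D n] D_large
      by (simp add: A_def conj_assoc cong: conj_cong)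
    then have "(\<Sum>n\<in>J. prob {z \<in> space M. infnorm (F n z) \<le> r} - e) \<le> (\<Sum>n\<in>J. prob (A n))"
      by (rule sum_mono)
    also have "\<dots> = expectation (\<lambda>z. \<Sum>n\<in>J. indicator (A n) z)"
      by (simp add: emeasure_eq_measure)
    also have "\<dots> \<le> expectation (\<lambda>_. c * (r + R) ^ DIM('b))"
    proof (rule integral_mono)
      fix z
      assume "z \<in> space M"
      then have "(\<Sum>n\<in>J. indicator (A n) z) = weighted_visits J 0 r (\<lambda>z. indicator D z * 1) z"
        unfolding weighted_visits_def by (intro sum.cong) (auto simp: A_def indicator_def)
      then show "(\<Sum>n\<in>J. indicator (A n) z) \<le> c * (r + R) ^ DIM('b)"
        using visits_bounded_onD[OF D that, of 0 z] by simp
    qed (simp_all add: emeasure_eq_measure)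
    finally show ?thesis
      by (simp add: prob_space)
  qed
  with \<open>R \<ge> 0\<close> show ?thesis
    by (rule that)
qed

end

lemma sum_inverse_dyadic_ge:
  assumes "Q > 0"
  shows "real k / 2 \<le> (\<Sum>n\<in>{Q..<2 ^ k * Q}. 1 / real n)"
proof (induction k)
  case (Suc k)
  have "(1 / 2 :: real) = (\<Sum>n\<in>{2 ^ k * Q..<2 ^ Suc k * Q}. 1 / real (2 ^ Suc k * Q))"
    using assms by (simp add: field_simps)
  also have "\<dots> \<le> (\<Sum>n\<in>{2 ^ k * Q..<2 ^ Suc k * Q}. 1 / real n)"
  proof (intro sum_mono divide_left_mono)
    fix n
    assume n: "n \<in> {2 ^ k * Q..<2 ^ Suc k * Q}"
    then show "real n \<le> real (2 ^ Suc k * Q)"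
      unfolding of_nat_le_iff by simp
    have "0 < 2 ^ k * Q"
      using assms by simp
    then have "0 < n"
      using n by simp
    then show "0 < real (2 ^ Suc k * Q) * real n"
      using assms by simp
  qed simp
  finally have "real (Suc k) / 2 \<le> (\<Sum>n\<in>{Q..<2 ^ k * Q}. 1 / real n)
      + (\<Sum>n\<in>{2 ^ k * Q..<2 ^ Suc k * Q}. 1 / real n)"
    using Suc by simp
  also have "\<dots> = (\<Sum>n\<in>{Q..<2 ^ Suc k * Q}. 1 / real n)"
    using mult_le_mono1[of 1 "2 ^ k" Q] by (intro sum.atLeastLessThan_concat) auto
  finally show ?case .
qed simp

lemma sum_inverse_dyadic_diff_ge:
  assumes "Q > 0" "a \<ge> 0" "e \<ge> 0"
  shows "a * real k / 2 - e * real (2 ^ k * Q) \<le> (\<Sum>n\<in>{Q..<2 ^ k * Q}. a / real n - e)"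
proof -
  define J where "J = {Q..<2 ^ k * Q}"
  have "a * (real k / 2) - e * real (2 ^ k * Q) \<le> a * (\<Sum>n\<in>J. 1 / real n) - e * real (card J)"
  proof (intro diff_mono mult_left_mono)
    show "real k / 2 \<le> (\<Sum>n\<in>J. 1 / real n)"
      unfolding J_def using \<open>Q > 0\<close> by (rule sum_inverse_dyadic_ge)
    show "real (card J) \<le> real (2 ^ k * Q)"
      unfolding of_nat_le_iff by (simp add: J_def)
  qed (use assms in auto)
  also have "\<dots> = (\<Sum>n\<in>J. a / real n - e)"
    by (simp add: sum_subtractf sum_distrib_left)
  finally show ?thesis
    by (simp add: J_def)
qed

subsection \<open>Recurrence\<close>

context cohomology_invariant_cocycle
begin

lemma not_visits_bounded_1:
  assumes "b > 0"
    and lower: "\<And>n r. r > 0 \<Longrightarrow> r ^ DIM('b) \<le> real n \<Longrightarrow>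
      b * r ^ DIM('b) / real n \<le> prob {z \<in> space M. infnorm (F n z) \<le> r}"
  shows "\<not> visits_bounded c (\<lambda>_. 1)"
proof
  assume bounded: "visits_bounded c (\<lambda>_. 1)"
  then have "0 \<le> c"
    by (rule visits_bounded_imp_nonneg)
  obtain k :: nat where "4 * c * 2 ^ DIM('b) / b < real k"
    using reals_Archimedean2 by blast
  then have k_large: "c * 2 ^ DIM('b) < b * real k / 4"
    using \<open>b > 0\<close> by (simp add: field_simps)
  then have "b * real k / 4 > 0"
    using \<open>0 \<le> c\<close> by (intro le_less_trans[OF _ k_large]) simp
  define e where "e = b * real k / 4 / 2 ^ k"
  have "e > 0"
    using \<open>b * real k / 4 > 0\<close> by (simp add: e_def)
  obtain R where "R \<ge> 0" and upper: "\<And>J r. finite J \<Longrightarrow> r \<ge> 0 \<Longrightarrow>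
      (\<Sum>n\<in>J. prob {z \<in> space M. infnorm (F n z) \<le> r} - e) \<le> c * (r + R) ^ DIM('b)"
    using sum_prob_le_if_visits_bounded[OF bounded \<open>e > 0\<close>] by blast
  define r where "r = nat \<lceil>R\<rceil> + 1"
  have r: "r > 0" "R \<le> real r"
    by (simp_all add: r_def) linarith
  define Q where "Q = r ^ DIM('b)"
  define J where "J = {Q..<2 ^ k * Q}"
  have "Q > 0"
    using r by (simp add: Q_def)
  have "b * real k / 4 * real Q = b * real Q * real k / 2 - e * real (2 ^ k * Q)"
    by (simp add: e_def)
  also have "\<dots> \<le> (\<Sum>n\<in>J. b * real Q / real n - e)"
    unfolding J_def using \<open>Q > 0\<close> \<open>b > 0\<close> \<open>e > 0\<close> by (intro sum_inverse_dyadic_diff_ge) simp_all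
  also have "\<dots> \<le> (\<Sum>n\<in>J. prob {z \<in> space M. infnorm (F n z) \<le> real r} - e)"
    using lower[of "real r"] r by (intro sum_mono diff_mono) (auto simp: J_def Q_def)
  also have "\<dots> \<le> c * (real r + R) ^ DIM('b)"
    by (intro upper) (simp_all add: J_def)
  also have "\<dots> \<le> c * (2 * real r) ^ DIM('b)"
    using \<open>0 \<le> c\<close> \<open>R \<ge> 0\<close> r by (intro mult_left_mono power_mono) auto
  also have "\<dots> = c * 2 ^ DIM('b) * real Q"
    by (simp add: power_mult_distrib Q_def)
  finally have "b * real k / 4 \<le> c * 2 ^ DIM('b)"
    using \<open>Q > 0\<close> by simp
  then show False
    using k_large by simp
qed

theorem AE_liminf_infnorm_eq_0:
  assumes "b > 0"
    and lower: "\<And>n r. r > 0 \<Longrightarrow> r ^ DIM('b) \<le> real n \<Longrightarrow>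
      b * r ^ DIM('b) / real n \<le> prob {z \<in> space M. infnorm (F n z) \<le> r}"
  shows "AE z in M. liminf (\<lambda>n. ereal (infnorm (F n z))) = 0"
proof (rule AE_liminf_eq_0I)
  fix s :: real and N
  assume "s > 0"
  define C where "C = {z \<in> space M. \<forall>n\<ge>N. infnorm (F n z) > s}"
  have [measurable]: "C \<in> events"
    unfolding C_def by measurable
  have "visits_bounded (real N * (2 / s) ^ DIM('b)) (indicator C)"
    using \<open>s > 0\<close> by (rule visits_bounded_indicator) (simp add: C_def)
  then have "prob C > 0 \<Longrightarrow> \<exists>c. visits_bounded c (\<lambda>_. 1)"
    using visits_bounded_1[of _ "indicator C"] by (auto simp: indicator_def)
  then show "prob {z \<in> space M. \<forall>n\<ge>N. infnorm (F n z) > s} = 0"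
    using not_visits_bounded_1[OF assms] unfolding C_def[symmetric]
    by (auto simp: zero_less_measure_iff)
qed (simp_all add: infnorm_pos_le)

end

lemma (in prob_space) cohomology_invariant_cocycle_difference:
  fixes f :: "'a \<Rightarrow> 'b::euclidean_space"
  assumes T: "measure_preserving M T" "ergodic M T" and [measurable]: "f \<in> borel_measurable M"
  shows "cohomology_invariant_cocycle (M \<Otimes>\<^sub>M M) (map_prod T T) (\<lambda>(x, y). f x - f y)
    {map_prod T id, map_prod id T}"
proof -
  interpret P: pair_prob_space M M ..
  note map_prod = measure_preserving_map_prod[OF sigma_finite_measure_axioms]
  show ?thesis
  proof unfold_locales
    show "measure_preserving (M \<Otimes>\<^sub>M M) (map_prod T T)"
      using T(1) T(1) by (rule map_prod)
    show "measure_preserving (M \<Otimes>\<^sub>M M) g" if "g \<in> {map_prod T id, map_prod id T}" for g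
      using that map_prod[OF T(1) measure_preserving_id] map_prod[OF measure_preserving_id T(1)]
      by auto
    show "jointly_ergodic (M \<Otimes>\<^sub>M M) {map_prod T id, map_prod id T}"
      by (rule P.jointly_ergodic_coordinate_maps[OF T T])
    show "map_prod T T (g z) = g (map_prod T T z)" if "g \<in> {map_prod T id, map_prod id T}" for g z
      using that by (cases z) auto
    show "\<exists>p\<in>borel_measurable (M \<Otimes>\<^sub>M M). \<forall>z. (\<lambda>(x, y). f x - f y) (g z)
        = (\<lambda>(x, y). f x - f y) z + p (map_prod T T z) - p z"
      if "g \<in> {map_prod T id, map_prod id T}" for g
      using that
    proof (elim insertE emptyE)
      assume "g = map_prod T id"
      then show ?thesis
        by (intro bexI[of _ "\<lambda>z. f (fst z)"]) auto
    next
      assume "g = map_prod id T"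
      then show ?thesis
        by (intro bexI[of _ "\<lambda>z. - f (snd z)"]) auto
    qed
  qed measurable
qed

theorem (in prob_space) AE_liminf_infnorm_difference_eq_0:
  fixes f :: "'a \<Rightarrow> 'b::euclidean_space"
  assumes T: "measure_preserving M T" "ergodic M T" and f: "f \<in> borel_measurable M"
    and "e > 0" "K > 0"
    and concentrated: "\<And>n. n \<ge> 1 \<Longrightarrow>
      e \<le> prob {x \<in> space M. infnorm (cocycle T f n x) \<le> K * real n powr (1 / DIM('b))}"
  shows "AE z in M \<Otimes>\<^sub>M M.
    liminf (\<lambda>n. ereal (infnorm (cocycle (map_prod T T) (\<lambda>(x, y). f x - f y) n z))) = 0"
proof -
  interpret P: pair_prob_space M M ..
  interpret cohomology_invariant_cocycle "M \<Otimes>\<^sub>M M" "map_prod T T" "\<lambda>(x, y). f x - f y"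
    "{map_prod T id, map_prod id T}"
    using T f by (rule cohomology_invariant_cocycle_difference)
  define d where "d = DIM('b)"
  have "d > 0"
    by (simp add: d_def)
  show ?thesis
  proof (rule AE_liminf_infnorm_eq_0[where b = "e\<^sup>2 / (2 * K + 2) ^ d"], fold d_def)
    show "e\<^sup>2 / (2 * K + 2) ^ d > 0"
      using \<open>e > 0\<close> \<open>K > 0\<close> by simp
    fix n and r :: real
    assume "r > 0" "r ^ d \<le> real n"
    have "0 < r ^ d"
      using \<open>r > 0\<close> by simp
    then have "n \<ge> 1"
      using \<open>r ^ d \<le> real n\<close> by linarith
    define t where "t = real n powr (1 / real d)"
    have t: "t ^ d = real n" "t > 0"
      using \<open>n \<ge> 1\<close> \<open>d > 0\<close> by (simp_all add: t_def powr_power)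
    then have "r \<le> t"
      using \<open>r ^ d \<le> real n\<close> \<open>d > 0\<close> \<open>r > 0\<close> by (metis less_imp_le power_mono_iff)
    have "e\<^sup>2 / (2 * K + 2) ^ d * r ^ d / real n = e\<^sup>2 / (2 * K + 2) ^ d * (r / t) ^ d"
      by (simp add: power_divide t)
    also have "\<dots> \<le> P.prob {z \<in> space (M \<Otimes>\<^sub>M M). infnorm (F n z) \<le> r}"
      unfolding d_def cocycle_map_prod_difference
      using concentrated[OF \<open>n \<ge> 1\<close>] \<open>r > 0\<close> \<open>r \<le> t\<close> \<open>e > 0\<close> \<open>K > 0\<close>
      by (intro prob_infnorm_difference_ge_scaled borel_measurable_cocycle T f)
        (simp_all add: t_def d_def)
    finally show "e\<^sup>2 / (2 * K + 2) ^ d * r ^ d / real n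
        \<le> P.prob {z \<in> space (M \<Otimes>\<^sub>M M). infnorm (F n z) \<le> r}" .
  qed
qed

lemma (in prob_space) uniformly_tight_imp_concentrated:
  assumes meas: "\<And>n. g n \<in> borel_measurable M" and tight: "uniformly_tight M g"
  shows "\<exists>e>0. \<exists>K>0. \<forall>n\<ge>1. prob {x \<in> space M. maxnorm (g n x) \<le> K} > e"
proof -
  obtain C where "compact C" and C: "\<And>n. n \<ge> 1 \<Longrightarrow> measure (distr M borel (g n)) C > 1 - 1 / 2"
    using tight[unfolded uniformly_tight_def, rule_format, of "1 / 2"] by auto
  obtain K where "K > 0" and K: "\<And>v. v \<in> C \<Longrightarrow> norm v \<le> K"
    using compact_imp_bounded[OF \<open>compact C\<close>] by (auto simp: bounded_pos)
  have "prob {x \<in> space M. maxnorm (g n x) \<le> K} > 1 / 2" if "n \<ge> 1" for n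
  proof -
    have [measurable]: "g n \<in> borel_measurable M"
      by (rule meas)
    have "1 / 2 < prob (g n -` C \<inter> space M)"
      using C[OF that] \<open>compact C\<close> by (simp add: measure_distr borel_compact)
    also have "\<dots> \<le> prob {x \<in> space M. maxnorm (g n x) \<le> K}"
      unfolding maxnorm_eq_infnorm
      using K infnorm_le_norm order_trans by (intro finite_measure_mono) (blast, measurable)
    finally show ?thesis .
  qed
  then show ?thesis
    using \<open>K > 0\<close> by (intro exI[of _ "1 / 2"] conjI exI[of _ K]) auto
qed

theorem theorem14:
  fixes M :: "'a::polish_space measure"
    and T :: "'a \<Rightarrow> 'a"
    and f :: "'a \<Rightarrow> real ^ 'n::finite"
  assumes "prob_space M"
    and "sets M = sets (borel :: 'a measure)"
    and "mp_automorphism M T"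
    and "ergodic M T"
    and "f \<in> borel_measurable M"
    and "uniformly_tight M (\<lambda>n x. cocycle T f n x /\<^sub>R (real n powr (1 / real CARD('n))))
         \<or> (\<exists>e>0. \<exists>K>0. \<forall>n\<ge>1.
              measure M {x \<in> space M.
                 maxnorm (cocycle T f n x /\<^sub>R (real n powr (1 / real CARD('n)))) \<le> K} > e)"
  shows "recurrent (M \<Otimes>\<^sub>M M) (\<lambda>(x, y). (T x, T y)) (\<lambda>(x, y). f x - f y)"
proof -
  interpret prob_space M by fact
  let ?g = "\<lambda>n x. cocycle T f n x /\<^sub>R (real n powr (1 / real CARD('n)))"
  have T: "measure_preserving M T"
    using assms(3) by (simp add: mp_automorphism_def)
  have "?g n \<in> borel_measurable M" for n
    using borel_measurable_cocycle[OF T assms(5)] by measurable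
  then obtain e K where "e > 0" "K > 0"
    and concentrated: "\<And>n. n \<ge> 1 \<Longrightarrow> e < prob {x \<in> space M. maxnorm (?g n x) \<le> K}"
    using assms(6) uniformly_tight_imp_concentrated[of ?g] by meson
  have "maxnorm (?g n x) \<le> K \<longleftrightarrow> infnorm (cocycle T f n x) \<le> K * real n powr (1 / real CARD('n))"
    if "n \<ge> 1" for n x
    using that by (simp add: maxnorm_eq_infnorm infnorm_mul field_simps)
  then have "e \<le> prob {x \<in> space M.
      infnorm (cocycle T f n x) \<le> K * real n powr (1 / DIM(real ^ 'n))}" if "n \<ge> 1" for n
    using concentrated[OF that] that by simp
  then show ?thesis
    using AE_liminf_infnorm_difference_eq_0[OF T assms(4,5) \<open>e > 0\<close> \<open>K > 0\<close>]
    by (simp add: recurrent_def maxnorm_eq_infnorm map_prod_def)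
qed

end
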